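(* Let $E_\alpha(z)=\sum_{k=0}^\infty \frac{z^k}{\Gamma(\alpha k+1)}$ be the Mittag-Leffler function. For $0<\alpha<1$, the function $x\mapsto E_\alpha(x^\alpha)$ is log-concave on $(0,\infty)$. For $1<\alpha<2$, the function $x\mapsto E_\alpha(x^\alpha)$ is log-convex on $(0,\infty)$. *)

theory Defs
  imports "HOL-Analysis.Analysis"
begin

definition mittag_leffler :: "real \<Rightarrow> real \<Rightarrow> real" where
  "mittag_leffler \<alpha> z = (\<Sum>k. z ^ k / Gamma (\<alpha> * real k + 1))"

definition log_concave_on :: "real set \<Rightarrow> (real \<Rightarrow> real) \<Rightarrow> bool" where
  "log_concave_on S f \<longleftrightarrow> (\<forall>x\<in>S. f x > 0) \<and> concave_on S (\<lambda>x. ln (f x))"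

definition log_convex_on :: "real set \<Rightarrow> (real \<Rightarrow> real) \<Rightarrow> bool" where
  "log_convex_on S f \<longleftrightarrow> (\<forall>x\<in>S. f x > 0) \<and> convex_on S (\<lambda>x. ln (f x))"

end

theory Submission
  imports Defs
begin

text \<open>
  With \<open>\<lambda> = N powr (- \<alpha>)\<close>, let \<open>a n\<close> be the coefficient of \<open>z ^ n\<close> in
  \<open>(\<Sum>k. \<lambda> ^ k * (1 - z) powr (- \<alpha> * k - 1))\<close>.
  Since the coefficient of \<open>z ^ n\<close> in \<open>(1 - z) powr (- s - 1)\<close> is asymptotic to
  \<open>n powr s / Gamma (s + 1)\<close>, Tannery's theorem gives \<open>a n \<longlonglongrightarrow> E\<^sub>\<alpha> (x powr \<alpha>)\<close> when
  \<open>n / N \<longlonglongrightarrow> x\<close>, so it is enough to show that the sequence \<open>a\<close> is log-concave or log-convex.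
  Summing the geometric series and multiplying by \<open>1 - z\<close> shows that \<open>a n - a (n - 1)\<close> is \<open>\<lambda>\<close> times
  the convolution of \<open>a\<close> with the coefficients of \<open>(1 - z) powr (1 - \<alpha>)\<close>; solving for \<open>a n\<close> gives a
  renewal equation \<open>a (n + 1) = (\<Sum>j\<le>n. c j * a (n - j))\<close>. For \<open>\<alpha> < 1\<close> the kernel satisfies
  \<open>c j \<le> 0\<close> for \<open>j \<ge> 1\<close>, and log-concavity of \<open>a\<close> follows by induction. For \<open>1 < \<alpha> < 2\<close> the kernel is
  positive and log-convex, and log-convexity is inherited by \<open>a\<close> (de Bruijn and Erdos).
\<close>

section \<open>Coefficients of negative powers of \<open>1 - z\<close>\<close>

text \<open>The coefficient of \<open>z ^ n\<close> in \<open>(1 - z) powr (- b)\<close>, for any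
  real \<open>b\<close>; the values \<open>b = \<alpha> - 1 < 0\<close> occur as well.\<close>

definition negbin :: "real \<Rightarrow> nat \<Rightarrow> real" where
  "negbin b n = pochhammer b n / fact n"

lemma negbin_0 [simp]: "negbin b 0 = 1"
  by (simp add: negbin_def)

lemma negbin_Suc: "negbin b (Suc n) = negbin b n * ((b + real n) / (real n + 1))"
  by (simp add: negbin_def pochhammer_Suc field_simps)

lemma negbin_pos: "b > 0 \<Longrightarrow> negbin b n > 0"
  by (simp add: negbin_def pochhammer_pos)

lemma negbin_zero_Suc [simp]: "negbin 0 (Suc n) = 0"
  by (simp add: negbin_def pochhammer_rec)

text \<open>Vandermonde convolution: the coefficients of
  \<open>(1 - z) powr (- a) * (1 - z) powr (- b)\<close>.\<close>

lemma negbin_add: "negbin (a + b) n = (\<Sum>j\<le>n. negbin a j * negbin b (n - j))"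
  unfolding negbin_def pochhammer_binomial_sum sum_divide_distrib
  by (rule sum.cong) (simp_all add: binomial_fact field_simps)

text \<open>Multiplication by \<open>1 - z\<close> lowers the parameter by one.\<close>

lemma negbin_diff: "negbin (b + 1) (Suc n) - negbin (b + 1) n = negbin b (Suc n)"
proof -
  have "negbin b (Suc n) = negbin (b + 1) n * (b / (real n + 1))"
    by (simp add: negbin_def pochhammer_rec field_simps)
  thus ?thesis
    by (simp add: negbin_Suc field_simps)
qed

lemma negbin_mono:
  assumes "b \<ge> 1" "m \<le> n"
  shows "negbin b m \<le> negbin b n"
  using assms(2)
proof (rule lift_Suc_mono_le[of "negbin b", rotated])
  fix n
  have "negbin b n * 1 \<le> negbin b n * ((b + real n) / (real n + 1))"
    using assms(1) negbin_pos[of b n] by (intro mult_left_mono) (auto simp: field_simps)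
  thus "negbin b n \<le> negbin b (Suc n)" by (simp add: negbin_Suc)
qed

lemma negbin_sums:
  assumes "0 \<le> z" "z < 1"
  shows "(\<lambda>n. negbin b n * z ^ n) sums (1 - z) powr (- b)"
proof -
  have "(\<lambda>n. ((-b) gchoose n) * (-z) ^ n) sums (1 + (-z)) powr (-b)"
    using assms by (intro gen_binomial_real) auto
  moreover have "((-b) gchoose n) * (-z) ^ n = negbin b n * z ^ n" for n
    by (simp add: gbinomial_pochhammer negbin_def power_minus[of z] flip: power_add mult_2)
  ultimately show ?thesis by simp
qed

text \<open>Gauss's limit formula for \<open>1 / Gamma\<close>.\<close>

lemma negbin_tendsto: "(\<lambda>n. negbin (s + 1) n * real n powr (- s)) \<longlonglongrightarrow> 1 / Gamma (s + 1)"
proof -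
  have "(\<lambda>n. ((s + real n) gchoose n) * exp (- s * ln (real n))) \<longlonglongrightarrow> rGamma (s + 1)"
    using Gamma_gbinomial[of s] by simp
  moreover have "\<forall>\<^sub>F n in sequentially. ((s + real n) gchoose n) * exp (- s * ln (real n)) =
      negbin (s + 1) n * real n powr (- s)"
    using eventually_gt_at_top[of 0]
    by eventually_elim (simp add: gbinomial_pochhammer' negbin_def powr_def)
  ultimately show ?thesis
    by (simp add: Lim_transform_eventually rGamma_inverse_Gamma inverse_eq_divide)
qed

text \<open>Monotonicity in \<open>n\<close> bounds \<open>n + 1\<close> consecutive terms of the binomial series from below,
  which gains the factor \<open>1 / (n + 1)\<close> over the bound by a single term; without it the
  estimate would not be uniform in \<open>N\<close>.\<close>

lemma negbin_scaled_le:
  assumes s: "s \<ge> 0" and N: "N \<ge> 4"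
  shows "N powr (- s) * negbin (s + 1) n
         \<le> N / (real n + 1) / 2 * exp (8 * real n / N) * 2 powr (- s)"
proof -
  \<comment> \<open>Then \<open>1 - z = 2 / N\<close>, so the series sums to
    \<open>(N / 2) powr (s + 1)\<close>; the 2 yields the factor \<open>2 powr (- s)\<close>,
    geometric in \<open>k\<close> for \<open>s = \<alpha> * k\<close>.\<close>
  define z where "z = 1 - 2 / N"
  have z: "0 < z" "z < 1" using N by (auto simp: z_def field_simps)
  have pos: "negbin (s + 1) k \<ge> 0" for k using negbin_pos[of "s + 1" k] s by simp
  have "(real n + 1) * (negbin (s + 1) n * z ^ (2 * n)) =
        (\<Sum>j\<in>{n..2*n}. negbin (s + 1) n * z ^ (2 * n))"
    by simp
  also have "\<dots> \<le> (\<Sum>j\<in>{n..2*n}. negbin (s + 1) j * z ^ j)"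
    using s z pos by (intro sum_mono mult_mono negbin_mono power_decreasing) auto
  also have "\<dots> \<le> (\<Sum>j. negbin (s + 1) j * z ^ j)"
    using negbin_sums[of z "s + 1"] z pos
    by (intro sum_le_suminf) (auto simp: sums_iff)
  also have "\<dots> = (1 - z) powr (- (s + 1))"
    using negbin_sums[of z "s + 1"] z by (simp add: sums_iff)
  also have "\<dots> = (2 / N) powr (- (s + 1))" by (simp add: z_def)
  also have "\<dots> = N / 2 * (N powr s * 2 powr (- s))"
    using N by (simp only: powr_minus powr_divide powr_add) (simp add: field_simps)
  finally have 1: "(real n + 1) * (negbin (s + 1) n * z ^ (2 * n)) \<le> N / 2 * (N powr s * 2 powr (- s))" .
  \<comment> \<open>The loss \<open>z ^ (2 * n)\<close> is paid for by
    \<open>1 / z \<le> 1 + 4 / N \<le> exp (4 / N)\<close>; the first inequality amounts to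
    \<open>N \<ge> 4\<close>.\<close>
  have "1 \<le> (1 - 2 / N) * (1 + 4 / N)"
    using N by (simp add: field_simps)
  also have "\<dots> \<le> z * exp (4 / N)"
    unfolding z_def using N by (intro mult_left_mono exp_ge_add_one_self) auto
  finally have "1 \<le> (z * exp (4 / N)) ^ (2 * n)" by (rule one_le_power)
  also have "\<dots> = z ^ (2 * n) * exp (8 * real n / N)"
    by (simp add: power_mult_distrib exp_of_nat_mult[symmetric] mult_ac)
  finally have 2: "1 \<le> z ^ (2 * n) * exp (8 * real n / N)" .
  have "N powr (- s) * negbin (s + 1) n * 1
        \<le> N powr (- s) * negbin (s + 1) n * (z ^ (2 * n) * exp (8 * real n / N))"
    using 2 pos by (intro mult_left_mono) auto
  also have "\<dots> = N powr (- s) / (real n + 1) * exp (8 * real n / N) *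
      ((real n + 1) * (negbin (s + 1) n * z ^ (2 * n)))"
    by (simp add: field_simps)
  also have "\<dots> \<le> N powr (- s) / (real n + 1) * exp (8 * real n / N) *
      (N / 2 * (N powr s * 2 powr (- s)))"
    using N by (intro mult_left_mono 1) auto
  also have "\<dots> = N / (real n + 1) / 2 * exp (8 * real n / N) * 2 powr (- s)"
    using N by (simp add: powr_minus)
  finally show ?thesis by simp
qed

section \<open>The approximating sequence and its renewal equation\<close>

definition ml_approx :: "real \<Rightarrow> real \<Rightarrow> nat \<Rightarrow> real" where
  "ml_approx \<alpha> N n = (\<Sum>k. N powr (- \<alpha> * real k) * negbin (\<alpha> * real k + 1) n)"

lemma summable_powr_neg_mult:
  assumes "b > 1" "\<alpha> > 0"
  shows "summable (\<lambda>k. b powr (- (\<alpha> * real k)))"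
proof -
  have "b powr (- \<alpha>) < 1" using assms by (simp add: powr_less_one)
  hence "summable (\<lambda>k. (b powr (- \<alpha>)) ^ k)" by (intro summable_geometric) auto
  thus ?thesis using assms by (simp add: powr_powr powr_realpow[symmetric])
qed

lemma summable_ml_approx:
  assumes "\<alpha> > 0" "N \<ge> 4"
  shows "summable (\<lambda>k. N powr (- \<alpha> * real k) * negbin (\<alpha> * real k + 1) n)"
proof (rule summable_comparison_test)
  show "summable (\<lambda>k. N / (real n + 1) / 2 * exp (8 * real n / N) * 2 powr (- (\<alpha> * real k)))"
    using assms by (intro summable_mult summable_powr_neg_mult) auto
  have "norm (N powr (- \<alpha> * real k) * negbin (\<alpha> * real k + 1) n)
    \<le> N / (real n + 1) / 2 * exp (8 * real n / N) * 2 powr (- (\<alpha> * real k))" for k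
    using negbin_scaled_le[of "\<alpha> * real k" N n] negbin_pos[of "\<alpha> * real k + 1" n] assms
    by (simp add: add_nonneg_pos)
  thus "\<exists>K. \<forall>k\<ge>K. norm (N powr (- \<alpha> * real k) * negbin (\<alpha> * real k + 1) n)
    \<le> N / (real n + 1) / 2 * exp (8 * real n / N) * 2 powr (- (\<alpha> * real k))" by blast
qed

lemma ml_approx_pos:
  assumes "\<alpha> > 0" "N \<ge> 4"
  shows "ml_approx \<alpha> N n > 0"
  unfolding ml_approx_def using assms
  by (intro suminf_pos summable_ml_approx mult_pos_pos negbin_pos) (auto simp: add_nonneg_pos)

text \<open>Term by term in \<open>k\<close>: multiplying by \<open>1 - z\<close> turns the summand
  \<open>k = 0\<close> into a constant, and the exponent left for \<open>k + 1\<close> splits as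
  \<open>- \<alpha> * (k + 1) = (1 - \<alpha>) + (- \<alpha> * k - 1)\<close>, to which the
  convolution \<open>negbin_add\<close> applies.\<close>

lemma ml_approx_rec:
  assumes "\<alpha> > 0" "N \<ge> 4"
  shows "ml_approx \<alpha> N (Suc n) - ml_approx \<alpha> N n =
         N powr (- \<alpha>) * (\<Sum>j\<le>Suc n. negbin (\<alpha> - 1) j * ml_approx \<alpha> N (Suc n - j))"
proof -
  let ?t = "\<lambda>n k. N powr (- \<alpha> * real k) * negbin (\<alpha> * real k + 1) n"
  note S = summable_ml_approx[OF assms]
  have diff: "?t (Suc n) k - ?t n k = N powr (- \<alpha> * real k) * negbin (\<alpha> * real k) (Suc n)" for k
    using negbin_diff[of "\<alpha> * real k" n] by (simp flip: right_diff_distrib)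
  have step: "?t (Suc n) (Suc k) - ?t n (Suc k) =
      N powr (- \<alpha>) * (\<Sum>j\<le>Suc n. negbin (\<alpha> - 1) j * ?t (Suc n - j) k)" for k
  proof -
    have "negbin (\<alpha> * real (Suc k)) (Suc n) = negbin ((\<alpha> - 1) + (\<alpha> * real k + 1)) (Suc n)"
      by (simp add: algebra_simps)
    also have "\<dots> = (\<Sum>j\<le>Suc n. negbin (\<alpha> - 1) j * negbin (\<alpha> * real k + 1) (Suc n - j))"
      by (rule negbin_add)
    finally have "negbin (\<alpha> * real (Suc k)) (Suc n) =
      (\<Sum>j\<le>Suc n. negbin (\<alpha> - 1) j * negbin (\<alpha> * real k + 1) (Suc n - j))" .
    moreover have "N powr (- \<alpha> * real (Suc k)) = N powr (- \<alpha>) * N powr (- \<alpha> * real k)"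
      by (simp add: powr_add[symmetric] algebra_simps)
    ultimately show ?thesis
      unfolding diff by (simp only: sum_distrib_left) (simp add: mult_ac)
  qed
  have "ml_approx \<alpha> N (Suc n) - ml_approx \<alpha> N n = (\<Sum>k. ?t (Suc n) k - ?t n k)"
    unfolding ml_approx_def by (intro suminf_diff S)
  also have "\<dots> = (\<Sum>k. ?t (Suc n) (Suc k) - ?t n (Suc k))"
  proof -
    have "?t (Suc n) 0 - ?t n 0 = 0" unfolding diff by simp
    thus ?thesis using suminf_split_head[OF summable_diff[OF S S], of "Suc n" n] by linarith
  qed
  also have "\<dots> = (\<Sum>k. N powr (- \<alpha>) * (\<Sum>j\<le>Suc n. negbin (\<alpha> - 1) j * ?t (Suc n - j) k))"
    by (simp only: step)
  also have "\<dots> = N powr (- \<alpha>) * (\<Sum>k. \<Sum>j\<le>Suc n. negbin (\<alpha> - 1) j * ?t (Suc n - j) k)"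
    by (intro suminf_mult summable_sum summable_mult S)
  also have "(\<Sum>k. \<Sum>j\<le>Suc n. negbin (\<alpha> - 1) j * ?t (Suc n - j) k) =
      (\<Sum>j\<le>Suc n. \<Sum>k. negbin (\<alpha> - 1) j * ?t (Suc n - j) k)"
    by (intro suminf_sum summable_mult S)
  also have "\<dots> = (\<Sum>j\<le>Suc n. negbin (\<alpha> - 1) j * ml_approx \<alpha> N (Suc n - j))"
    unfolding ml_approx_def by (intro sum.cong refl suminf_mult S)
  finally show ?thesis .
qed

text \<open>In \<open>ml_approx_rec\<close> the summand \<open>j = 0\<close> contains the unknown
  \<open>ml_approx \<alpha> N (Suc n)\<close> itself. Moving it to the left gives the denominator;
  the term \<open>ml_approx \<alpha> N n\<close> gives the extra 1 at \<open>j = 0\<close>.\<close>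

definition ml_kernel :: "real \<Rightarrow> real \<Rightarrow> nat \<Rightarrow> real" where
  "ml_kernel \<alpha> N j =
     ((if j = 0 then 1 else 0) + N powr (- \<alpha>) * negbin (\<alpha> - 1) (Suc j)) / (1 - N powr (- \<alpha>))"

lemma ml_approx_renewal:
  assumes "\<alpha> > 0" "N \<ge> 4"
  shows "ml_approx \<alpha> N (Suc n) = (\<Sum>j\<le>n. ml_kernel \<alpha> N j * ml_approx \<alpha> N (n - j))"
proof -
  let ?q = "N powr (- \<alpha>)" and ?a = "ml_approx \<alpha> N" and ?e = "negbin (\<alpha> - 1)"
  have q: "1 - ?q > 0" using assms by (simp add: powr_less_one)
  have "(\<Sum>j\<le>Suc n. ?e j * ?a (Suc n - j)) = ?a (Suc n) + (\<Sum>j\<le>n. ?e (Suc j) * ?a (n - j))"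
    by (simp add: sum.atMost_Suc_shift del: sum.atMost_Suc)
  hence "(1 - ?q) * ?a (Suc n) = ?a n + ?q * (\<Sum>j\<le>n. ?e (Suc j) * ?a (n - j))"
    using ml_approx_rec[OF assms, of n] by (simp add: algebra_simps)
  also have "?a n = (\<Sum>j\<le>n. (if j = 0 then 1 else 0) * ?a (n - j))"
    by (simp add: if_distrib[of "\<lambda>x. x * _"] cong: if_cong)
  also have "\<dots> + ?q * (\<Sum>j\<le>n. ?e (Suc j) * ?a (n - j)) =
      (\<Sum>j\<le>n. ((if j = 0 then 1 else 0) + ?q * ?e (Suc j)) * ?a (n - j))"
    by (simp only: sum_distrib_left sum.distrib[symmetric] distrib_right mult.assoc)
  finally have "?a (Suc n) = (\<Sum>j\<le>n. ((if j = 0 then 1 else 0) + ?q * ?e (Suc j)) * ?a (n - j)) / (1 - ?q)"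
    using q by (simp add: field_simps)
  thus ?thesis
    by (simp only: ml_kernel_def sum_divide_distrib) (simp add: mult_ac)
qed

section \<open>Log-convex and log-concave renewal sequences\<close>

text \<open>Monotonicity on an initial segment only, which is what a strong induction hypothesis
  supplies.\<close>

lemma mono_on_atMost_SucI:
  fixes R :: "nat \<Rightarrow> real"
  assumes "\<And>i. i < n \<Longrightarrow> R i \<le> R (Suc i)" "i \<le> n"
  shows "R i \<le> R n"
  using assms(2)
proof (induction rule: inc_induct)
  case (step m)
  thus ?case using assms(1)[of m] by linarith
qed simp

text \<open>Compare the renewal equations for \<open>u (n + 1)\<close> and \<open>u (n + 2)\<close> after
  subtracting the current ratio; log-convexity of \<open>c\<close> controls the shift.\<close>

lemma renewal_ratio_mono:
  fixes u c :: "nat \<Rightarrow> real"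
  assumes rec: "\<And>n. u (Suc n) = (\<Sum>j\<le>n. c j * u (n - j))"
    and u: "\<And>n. u n > 0" and c: "\<And>j. c j > 0"
    and lc: "\<And>j. c (Suc j) / c j \<le> c (Suc (Suc j)) / c (Suc j)"
  shows "u (Suc n) / u n \<le> u (Suc (Suc n)) / u (Suc n)"
proof (induction n rule: less_induct)
  case (less n)
  define R where "R = (\<lambda>n. u (Suc n) / u n)"
  have Ru: "u (Suc m) = R m * u m" for m using u[of m] by (simp add: R_def)
  have R: "R i \<le> R n" if "i \<le> n" for i
    using mono_on_atMost_SucI[of n R i] less that by (simp add: R_def)
  \<comment> \<open>The goal is equivalent to \<open>D (Suc n) \<ge> 0\<close>, while the induction
    hypothesis makes \<open>D\<close> nonpositive up to \<open>n\<close>.\<close>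
  define D where "D = (\<lambda>m. u (Suc m) - R n * u m)"
  have D: "D m \<le> 0" if "m \<le> n" for m
    using R[OF that] u[of m] by (simp add: D_def Ru mult_right_mono)
  have D0: "D n = 0" by (simp add: D_def Ru)
  \<comment> \<open>The largest ratio of \<open>c\<close> up to \<open>n\<close>; since
    \<open>\<rho> * c n = c (Suc n)\<close>, the boundary terms cancel in the end.\<close>
  define \<rho> where "\<rho> = c (Suc n) / c n"
  have \<rho>: "c (Suc j) \<le> \<rho> * c j" if "j \<le> n" for j
    using mono_on_atMost_SucI[of n "\<lambda>j. c (Suc j) / c j" j] lc that c[of j]
    by (simp add: \<rho>_def field_simps)
  have expand: "D (Suc m) = c (Suc m) * u 0 + (\<Sum>j\<le>m. c j * D (m - j))" for m
  proof -
    have "u (Suc (Suc m)) = c (Suc m) * u 0 + (\<Sum>j\<le>m. c j * u (Suc (m - j)))"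
      by (subst rec) (simp add: Suc_diff_le)
    thus ?thesis
      by (simp add: D_def rec[of m] sum_distrib_left sum_subtractf algebra_simps)
  qed
  have "D (Suc n) \<ge> 0"
  proof (cases n)
    case 0
    thus ?thesis using expand[of n] c[of 1] u[of 0] D0 by simp
  next
    case (Suc m)
    have "(\<Sum>j\<le>n. c j * D (n - j)) = (\<Sum>j\<le>m. c (Suc j) * D (m - j))"
      using D0 unfolding Suc by (subst sum.atMost_Suc_shift) simp
    \<comment> \<open>As \<open>D \<le> 0\<close>, enlarging the weights lowers the sum, which then
      is \<open>\<rho>\<close> times the one in \<open>expand[of m]\<close>.\<close>
    also have "\<dots> \<ge> (\<Sum>j\<le>m. (\<rho> * c j) * D (m - j))"
      using Suc by (intro sum_mono mult_right_mono_neg \<rho> D) auto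
    also have "(\<Sum>j\<le>m. (\<rho> * c j) * D (m - j)) = \<rho> * (D n - c n * u 0)"
      unfolding Suc expand[of m] by (simp add: sum_distrib_left mult_ac)
    also have "\<dots> = - c (Suc n) * u 0"
      using D0 c[of n] by (simp add: \<rho>_def)
    finally show ?thesis using expand[of n] by simp
  qed
  thus ?case using u[of n] u[of "Suc n"]
    by (simp add: D_def R_def field_simps)
qed

text \<open>Here \<open>D\<close> is nonnegative up to \<open>n\<close> by induction. The only
  weight of unknown sign, \<open>c 0\<close>, multiplies \<open>D n = 0\<close>, so every term of
  \<open>D (Suc n)\<close> is nonpositive.\<close>

lemma renewal_ratio_antimono:
  fixes u c :: "nat \<Rightarrow> real"
  assumes rec: "\<And>n. u (Suc n) = (\<Sum>j\<le>n. c j * u (n - j))"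
    and u: "\<And>n. u n > 0" and c: "\<And>j. c (Suc j) \<le> 0"
  shows "u (Suc (Suc n)) / u (Suc n) \<le> u (Suc n) / u n"
proof (induction n rule: less_induct)
  case (less n)
  define R where "R = (\<lambda>n. u (Suc n) / u n)"
  have Ru: "u (Suc m) = R m * u m" for m using u[of m] by (simp add: R_def)
  have R: "R i \<ge> R n" if "i \<le> n" for i
    using mono_on_atMost_SucI[of n "\<lambda>i. - R i" i] less that by (simp add: R_def)
  define D where "D = (\<lambda>m. u (Suc m) - R n * u m)"
  have D: "D m \<ge> 0" if "m \<le> n" for m
    using R[OF that] u[of m] by (simp add: D_def Ru mult_right_mono)
  have D0: "D n = 0" by (simp add: D_def Ru)
  have "u (Suc (Suc n)) = c (Suc n) * u 0 + (\<Sum>j\<le>n. c j * u (Suc (n - j)))"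
    by (subst rec) (simp add: Suc_diff_le)
  hence "D (Suc n) = c (Suc n) * u 0 + (\<Sum>j\<le>n. c j * D (n - j))"
    by (simp add: D_def rec[of n] sum_distrib_left sum_subtractf algebra_simps)
  moreover have "c j * D (n - j) \<le> 0" if "j \<le> n" for j
    using D0 D[of "n - j"] c by (cases j) (auto intro: mult_nonpos_nonneg)
  hence "(\<Sum>j\<le>n. c j * D (n - j)) \<le> 0" by (intro sum_nonpos) auto
  moreover have "c (Suc n) * u 0 \<le> 0" using c[of n] u[of 0] by (simp add: mult_nonpos_nonneg)
  ultimately have "D (Suc n) \<le> 0" by linarith
  thus ?case using u[of n] u[of "Suc n"]
    by (simp add: D_def R_def field_simps)
qed

section \<open>Sign and log-convexity of the kernel\<close>

lemma ml_approx_ratio_antimono: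
  assumes "0 < \<alpha>" "\<alpha> < 1" "N \<ge> 4"
  shows "ml_approx \<alpha> N (Suc (Suc n)) / ml_approx \<alpha> N (Suc n)
         \<le> ml_approx \<alpha> N (Suc n) / ml_approx \<alpha> N n"
proof (rule renewal_ratio_antimono[where c = "ml_kernel \<alpha> N"])
  fix j
  \<comment> \<open>The first coefficient is \<open>\<alpha> - 1 < 0\<close>; all later factors
    \<open>(\<alpha> - 1 + m) / (m + 1)\<close> with \<open>m \<ge> 1\<close> are positive.\<close>
  have "negbin (\<alpha> - 1) (Suc m) \<le> 0" for m
  proof (induction m)
    case 0
    thus ?case using assms by (simp add: negbin_Suc)
  next
    case (Suc m)
    thus ?case unfolding negbin_Suc[of _ "Suc m"]
      using assms by (intro mult_nonpos_nonneg) auto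
  qed
  thus "ml_kernel \<alpha> N (Suc j) \<le> 0"
    using assms by (auto simp: ml_kernel_def powr_less_one intro!: divide_nonpos_pos mult_nonneg_nonpos)
qed (use assms in \<open>auto intro: ml_approx_renewal ml_approx_pos\<close>)

lemma ml_approx_ratio_mono:
  assumes "1 < \<alpha>" "\<alpha> < 2" "N \<ge> 4"
  shows "ml_approx \<alpha> N (Suc n) / ml_approx \<alpha> N n
         \<le> ml_approx \<alpha> N (Suc (Suc n)) / ml_approx \<alpha> N (Suc n)"
proof (rule renewal_ratio_mono[where c = "ml_kernel \<alpha> N"])
  fix j
  let ?q = "N powr (- \<alpha>)" and ?e = "negbin (\<alpha> - 1)"
  have q: "?q > 0" "1 - ?q > 0" using assms by (auto simp: powr_less_one)
  have e: "?e m > 0" for m using assms by (intro negbin_pos) auto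
  show pos: "ml_kernel \<alpha> N j > 0" for j
    using q e[of "Suc j"] by (auto simp: ml_kernel_def intro!: divide_pos_pos add_nonneg_pos)
  have ratio: "ml_kernel \<alpha> N (Suc (Suc j)) / ml_kernel \<alpha> N (Suc j) =
      (\<alpha> - 1 + real (Suc (Suc j))) / (real (Suc (Suc j)) + 1)" for j
    using q e[of "Suc (Suc j)"] by (simp add: ml_kernel_def negbin_Suc[of _ "Suc (Suc j)"])
  \<comment> \<open>The extra 1 in the kernel at \<open>j = 0\<close> only lowers the first ratio.
    The others are \<open>1 - (2 - \<alpha>) / (m + 1)\<close>, increasing in \<open>m\<close>
    because \<open>\<alpha> < 2\<close>.\<close>
  have "ml_kernel \<alpha> N (Suc j) / ml_kernel \<alpha> N j \<le>
      (\<alpha> - 1 + real (Suc j)) / (real (Suc j) + 1)"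
  proof -
    have "ml_kernel \<alpha> N (Suc j) / ml_kernel \<alpha> N j \<le> 
        ml_kernel \<alpha> N (Suc j) / (?q * ?e (Suc j) / (1 - ?q))"
      using q e[of "Suc j"] pos[of j] pos[of "Suc j"]
      by (intro divide_left_mono mult_pos_pos divide_pos_pos) (auto simp: ml_kernel_def divide_right_mono)
    also have "\<dots> = (\<alpha> - 1 + real (Suc j)) / (real (Suc j) + 1)"
      using q e[of "Suc j"] by (simp add: ml_kernel_def negbin_Suc[of _ "Suc j"])
    finally show ?thesis .
  qed
  also have "\<dots> \<le> (\<alpha> - 1 + real (Suc (Suc j))) / (real (Suc (Suc j)) + 1)"
    using assms by (simp add: field_simps)
  also note ratio[symmetric]
  finally show "ml_kernel \<alpha> N (Suc j) / ml_kernel \<alpha> N j \<le>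
    ml_kernel \<alpha> N (Suc (Suc j)) / ml_kernel \<alpha> N (Suc j)" .
qed (use assms in \<open>auto intro: ml_approx_renewal ml_approx_pos\<close>)

section \<open>From convex sequences to convex functions\<close>

text \<open>The increment at \<open>r\<close> separates the mean increments on both sides. Clearing
  denominators lets indices coincide, as rounded points may.\<close>

lemma convex_seq_chord:
  fixes b :: "nat \<Rightarrow> real"
  assumes inc: "\<And>n. b (Suc n) - b n \<le> b (Suc (Suc n)) - b (Suc n)"
    and "p \<le> r" "r \<le> q"
  shows "(real q - real p) * b r \<le> (real q - real r) * b p + (real r - real p) * b q"
proof -
  define d where "d = (\<lambda>n. b (Suc n) - b n)"
  have d: "d i \<le> d j" if "i \<le> j" for i j
    using that by (rule lift_Suc_mono_le[of d, rotated]) (simp add: d_def inc)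
  have "b r - b p = sum d {p..<r}"
    unfolding d_def using \<open>p \<le> r\<close> by (simp add: sum_Suc_diff')
  also have "\<dots> \<le> (\<Sum>i\<in>{p..<r}. d r)" by (intro sum_mono d) auto
  finally have 1: "b r - b p \<le> (real r - real p) * d r" using \<open>p \<le> r\<close> by simp
  have "(real q - real r) * d r = (\<Sum>i\<in>{r..<q}. d r)" using \<open>r \<le> q\<close> by simp
  also have "\<dots> \<le> sum d {r..<q}" by (intro sum_mono d) auto
  also have "\<dots> = b q - b r"
    unfolding d_def using \<open>r \<le> q\<close> by (simp add: sum_Suc_diff')
  finally have 2: "(real q - real r) * d r \<le> b q - b r" .
  have "(real q - real r) * (b r - b p) \<le> (real q - real r) * ((real r - real p) * d r)"
    using 1 \<open>r \<le> q\<close> by (intro mult_left_mono) auto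
  also have "\<dots> = (real r - real p) * ((real q - real r) * d r)" by simp
  also have "\<dots> \<le> (real r - real p) * (b q - b r)"
    using 2 \<open>p \<le> r\<close> by (intro mult_left_mono) auto
  finally show ?thesis by (simp add: algebra_simps)
qed

lemma nat_floor_scaled_tendsto:
  fixes x :: real
  assumes "x \<ge> 0"
  shows "(\<lambda>N. real (nat \<lfloor>x * real N\<rfloor>) / real N) \<longlonglongrightarrow> x"
proof (rule tendsto_sandwich)
  show "\<forall>\<^sub>F N in sequentially. x - 1 / real N \<le> real (nat \<lfloor>x * real N\<rfloor>) / real N"
    using eventually_gt_at_top[of 0]
  proof eventually_elim
    case (elim N)
    have "x * real N - 1 \<le> real (nat \<lfloor>x * real N\<rfloor>)" using assms by linarith
    from divide_right_mono[OF this, of "real N"] show ?case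
      using elim by (simp add: diff_divide_distrib)
  qed
  show "\<forall>\<^sub>F N in sequentially. real (nat \<lfloor>x * real N\<rfloor>) / real N \<le> x"
    using eventually_gt_at_top[of 0]
  proof eventually_elim
    case (elim N)
    have "real (nat \<lfloor>x * real N\<rfloor>) \<le> x * real N" using assms by simp
    thus ?case using elim by (simp add: field_simps)
  qed
  show "(\<lambda>N. x - 1 / real N) \<longlonglongrightarrow> x"
    using tendsto_diff[OF tendsto_const[of x] lim_1_over_n] by simp
qed auto

text \<open>The rounded points need not form the exact convex combination; the chord inequality is
  applied with their actual distances, which after division by \<open>N\<close> converge to the true
  ones.\<close>

lemma convex_on_limit_of_convex_seqs:
  fixes f :: "real \<Rightarrow> real" and b :: "nat \<Rightarrow> nat \<Rightarrow> real"
  assumes inc: "\<And>N n. N \<ge> M \<Longrightarrow> b N (Suc n) - b N n \<le> b N (Suc (Suc n)) - b N (Suc n)"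
    and lim: "\<And>x. x > 0 \<Longrightarrow> (\<lambda>N. b N (nat \<lfloor>x * real N\<rfloor>)) \<longlonglongrightarrow> f x"
  shows "convex_on {0<..} f"
proof (rule convex_on_linorderI)
  fix t x y :: real
  assume t: "t > 0" "t < 1" and xy: "x \<in> {0<..}" "y \<in> {0<..}" "x < y"
  define z where "z = (1 - t) * x + t * y"
  have zx: "z - x = t * (y - x)" and yz: "y - z = (1 - t) * (y - x)"
    by (auto simp: z_def algebra_simps)
  have "t * (y - x) > 0" "(1 - t) * (y - x) > 0" using t xy by auto
  hence z: "x \<le> z" "z \<le> y" "z > 0" using xy zx yz by auto
  let ?n = "\<lambda>x N. nat \<lfloor>x * real N\<rfloor>"
  let ?s = "\<lambda>x N. real (?n x N) / real N"
  have "(\<lambda>N. (?s y N - ?s x N) * b N (?n z N)) \<longlonglongrightarrow> (y - x) * f z"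
    using xy z by (intro tendsto_intros nat_floor_scaled_tendsto lim) auto
  moreover have "(\<lambda>N. (?s y N - ?s z N) * b N (?n x N) + (?s z N - ?s x N) * b N (?n y N))
      \<longlonglongrightarrow> (y - z) * f x + (z - x) * f y"
    using xy z by (intro tendsto_intros nat_floor_scaled_tendsto lim) auto
  moreover have "\<forall>\<^sub>F N in sequentially. (?s y N - ?s x N) * b N (?n z N) \<le>
      (?s y N - ?s z N) * b N (?n x N) + (?s z N - ?s x N) * b N (?n y N)"
    using eventually_ge_at_top[of "max 1 M"]
  proof eventually_elim
    case (elim N)
    have "?n x N \<le> ?n z N" "?n z N \<le> ?n y N"
      using z by (auto intro!: nat_mono floor_mono mult_right_mono)
    hence "(real (?n y N) - real (?n x N)) * b N (?n z N) \<le>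
       (real (?n y N) - real (?n z N)) * b N (?n x N) + (real (?n z N) - real (?n x N)) * b N (?n y N)"
      using elim by (intro convex_seq_chord inc) auto
    from divide_right_mono[OF this, of "real N"] show ?case
      by (simp add: add_divide_distrib diff_divide_distrib[symmetric])
  qed
  ultimately have "(y - x) * f z \<le> (y - z) * f x + (z - x) * f y"
    by (intro tendsto_le[OF sequentially_bot]) 
  also have "\<dots> = (y - x) * ((1 - t) * f x + t * f y)"
    unfolding zx yz by (simp add: algebra_simps)
  finally show "f ((1 - t) *\<^sub>R x + t *\<^sub>R y) \<le> (1 - t) * f x + t * f y"
    using xy by (simp add: z_def)
qed simp

section \<open>Convergence to the Mittag-Leffler function\<close>

text \<open>Tannery's theorem in \<open>k\<close>. Summability is recorded too, since positivity of
  the limit relies on it.\<close>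

lemma ml_approx_dominated_convergence:
  fixes x \<alpha> :: real
  assumes "x > 0" "\<alpha> > 0"
  defines "f \<equiv> \<lambda>k. (x powr \<alpha>) ^ k / Gamma (\<alpha> * real k + 1)"
  shows "summable f \<and> (\<lambda>N. ml_approx \<alpha> (real N) (nat \<lfloor>x * real N\<rfloor>)) \<longlonglongrightarrow> suminf f"
proof -
  let ?n = "\<lambda>N. nat \<lfloor>x * real N\<rfloor>"
  let ?a = "\<lambda>k N. real N powr (- \<alpha> * real k) * negbin (\<alpha> * real k + 1) (?n N)"
  \<comment> \<open>This is \<open>negbin_scaled_le\<close> at \<open>n = ?n N\<close>, made
    independent of \<open>N\<close> by \<open>N / (n + 1) \<le> 1 / x\<close> and
    \<open>n / N \<le> x\<close>.\<close>
  let ?M = "\<lambda>k. 1 / x * exp (8 * x) * 2 powr (- (\<alpha> * real k))"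
  note nlim = nat_floor_scaled_tendsto[of x]
  have n_top: "filterlim ?n at_top sequentially"
    using \<open>x > 0\<close>
    by (intro filterlim_compose[OF filterlim_nat_sequentially]
          filterlim_compose[OF filterlim_floor_sequentially]
          filterlim_tendsto_pos_mult_at_top[OF tendsto_const] filterlim_real_sequentially)
  have lim: "?a k \<longlonglongrightarrow> f k" for k
  proof -
    let ?s = "\<alpha> * real k"
    have "(\<lambda>N. (real (?n N) / real N) powr ?s *
        (negbin (?s + 1) (?n N) * real (?n N) powr (- ?s))) \<longlonglongrightarrow> x powr ?s * (1 / Gamma (?s + 1))"
      using assms by (intro tendsto_mult tendsto_powr nlim tendsto_const
          filterlim_compose[OF negbin_tendsto n_top]) auto
    moreover have "\<forall>\<^sub>F N in sequentially. (real (?n N) / real N) powr ?s *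
        (negbin (?s + 1) (?n N) * real (?n N) powr (- ?s)) = ?a k N"
      \<comment> \<open>Since \<open>0 powr s = 0\<close> by convention, the powers of
        \<open>?n N\<close> cancel only once \<open>?n N > 0\<close>.\<close>
      using eventually_gt_at_top[of 0] eventually_compose_filterlim[OF eventually_gt_at_top[of 0] n_top]
    proof eventually_elim
      case (elim N)
      define m where "m = ?n N"
      have "real m > 0" "real N > 0" using elim unfolding m_def by (simp_all only: of_nat_0_less_iff)
      thus ?case unfolding m_def[symmetric] by (simp add: powr_divide powr_minus field_simps)
    qed
    ultimately have "?a k \<longlonglongrightarrow> x powr ?s * (1 / Gamma (?s + 1))"
      by (rule Lim_transform_eventually)
    thus ?thesis using assms by (simp add: f_def powr_powr powr_realpow[symmetric])
  qed
  have bound: "norm (?a k N) \<le> ?M k" if "N \<ge> 4" for k N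
  proof -
    define m where "m = ?n N"
    have s: "\<alpha> * real k \<ge> 0" using assms by simp
    have fl: "real m \<le> x * real N" "x * real N \<le> real m + 1"
      using assms(1) unfolding m_def by simp_all
    have "norm (?a k N) = real N powr (- (\<alpha> * real k)) * negbin (\<alpha> * real k + 1) m"
      using s negbin_pos[of "\<alpha> * real k + 1" m] by (simp add: abs_mult m_def)
    also have "\<dots> \<le> real N / (real m + 1) / 2 * exp (8 * real m / real N) *
        2 powr (- (\<alpha> * real k))"
      using that s by (intro negbin_scaled_le) auto
    also have "\<dots> \<le> 1 / x * exp (8 * x) * 2 powr (- (\<alpha> * real k))"
      using fl that assms(1) by (intro mult_right_mono mult_mono) (auto simp: field_simps)
    finally show ?thesis .
  qed
  have "\<forall>\<^sub>F (k, N) in at_top \<times>\<^sub>F sequentially. norm (?a k N) \<le> ?M k"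
    unfolding eventually_prod_sequentially using bound by (intro exI[of _ 4]) auto
  moreover have "summable ?M" using assms by (intro summable_mult summable_powr_neg_mult) auto
  ultimately have "summable (\<lambda>k. norm (f k)) \<and> (\<lambda>N. \<Sum>k. ?a k N) \<longlonglongrightarrow> suminf f"
    using tannerys_theorem[of ?a f sequentially ?M] lim by simp
  thus ?thesis unfolding ml_approx_def by (auto intro: summable_norm_cancel)
qed

lemma ml_approx_tendsto:
  assumes "x > 0" "\<alpha> > 0"
  shows "(\<lambda>N. ml_approx \<alpha> (real N) (nat \<lfloor>x * real N\<rfloor>)) \<longlonglongrightarrow> mittag_leffler \<alpha> (x powr \<alpha>)"
  using ml_approx_dominated_convergence[OF assms] by (simp add: mittag_leffler_def)

lemma mittag_leffler_pos:
  assumes "x > 0" "\<alpha> > 0"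
  shows "mittag_leffler \<alpha> (x powr \<alpha>) > 0"
  unfolding mittag_leffler_def
  using ml_approx_dominated_convergence[OF assms] assms
  by (intro suminf_pos divide_pos_pos Gamma_real_pos zero_less_power) (auto simp: add_nonneg_pos)

lemma ln_ml_approx_tendsto:
  assumes "x > 0" "\<alpha> > 0"
  shows "(\<lambda>N. ln (ml_approx \<alpha> (real N) (nat \<lfloor>x * real N\<rfloor>))) \<longlonglongrightarrow> ln (mittag_leffler \<alpha> (x powr \<alpha>))"
  using mittag_leffler_pos[OF assms] by (intro tendsto_ln ml_approx_tendsto assms) auto

theorem theorem2p2:
  shows "(\<forall>\<alpha>::real. 0 < \<alpha> \<and> \<alpha> < 1 \<longrightarrow>
            log_concave_on {0<..} (\<lambda>x. mittag_leffler \<alpha> (x powr \<alpha>))) \<and>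
         (\<forall>\<alpha>::real. 1 < \<alpha> \<and> \<alpha> < 2 \<longrightarrow>
            log_convex_on {0<..} (\<lambda>x. mittag_leffler \<alpha> (x powr \<alpha>)))"
proof (intro conjI allI impI)
  fix \<alpha> :: real
  assume \<alpha>: "0 < \<alpha> \<and> \<alpha> < 1"
  have "convex_on {0<..} (\<lambda>x. - ln (mittag_leffler \<alpha> (x powr \<alpha>)))"
  proof (rule convex_on_limit_of_convex_seqs[where M = 4])
    fix N n :: nat
    assume "N \<ge> 4"
    hence N: "real N \<ge> 4" by simp
    have pos: "ml_approx \<alpha> N m > 0" for m using \<alpha> N by (intro ml_approx_pos) auto
    \<comment> \<open>Increments of \<open>ln (ml_approx \<alpha> N n)\<close> in \<open>n\<close>
      are logarithms of consecutive ratios, so monotone ratios give a concave or convex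
      sequence.\<close>
    have "ln (ml_approx \<alpha> N (Suc (Suc n)) / ml_approx \<alpha> N (Suc n))
        \<le> ln (ml_approx \<alpha> N (Suc n) / ml_approx \<alpha> N n)"
      using ml_approx_ratio_antimono[of \<alpha> "real N" n] \<alpha> N pos by (subst ln_le_cancel_iff) auto
    thus "- ln (ml_approx \<alpha> N (Suc n)) - - ln (ml_approx \<alpha> N n) \<le>
        - ln (ml_approx \<alpha> N (Suc (Suc n))) - - ln (ml_approx \<alpha> N (Suc n))"
      using pos[of n] pos[of "Suc n"] pos[of "Suc (Suc n)"] by (simp add: ln_div)
  qed (use \<alpha> in \<open>auto intro!: tendsto_minus ln_ml_approx_tendsto\<close>)
  thus "log_concave_on {0<..} (\<lambda>x. mittag_leffler \<alpha> (x powr \<alpha>))"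
    using \<alpha> mittag_leffler_pos by (simp add: log_concave_on_def concave_on_def)
next
  fix \<alpha> :: real
  assume \<alpha>: "1 < \<alpha> \<and> \<alpha> < 2"
  have "convex_on {0<..} (\<lambda>x. ln (mittag_leffler \<alpha> (x powr \<alpha>)))"
  proof (rule convex_on_limit_of_convex_seqs[where M = 4])
    fix N n :: nat
    assume "N \<ge> 4"
    hence N: "real N \<ge> 4" by simp
    have pos: "ml_approx \<alpha> N m > 0" for m using \<alpha> N by (intro ml_approx_pos) auto
    have "ln (ml_approx \<alpha> N (Suc n) / ml_approx \<alpha> N n)
        \<le> ln (ml_approx \<alpha> N (Suc (Suc n)) / ml_approx \<alpha> N (Suc n))"
      using ml_approx_ratio_mono[of \<alpha> "real N" n] \<alpha> N pos by (subst ln_le_cancel_iff) auto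
    thus "ln (ml_approx \<alpha> N (Suc n)) - ln (ml_approx \<alpha> N n) \<le>
        ln (ml_approx \<alpha> N (Suc (Suc n))) - ln (ml_approx \<alpha> N (Suc n))"
      using pos[of n] pos[of "Suc n"] pos[of "Suc (Suc n)"] by (simp add: ln_div)
  qed (use \<alpha> in \<open>auto intro!: ln_ml_approx_tendsto\<close>)
  thus "log_convex_on {0<..} (\<lambda>x. mittag_leffler \<alpha> (x powr \<alpha>))"
    using \<alpha> mittag_leffler_pos by (simp add: log_convex_on_def)
qed

end
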